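(* Let $t_n^{\#3}$ be the number of rows with the value true in the truth tables of all the bracketed implications with $n$ variables, case 3. Then, as $n\to\infty$, $$t_n^{\#3} \sim \left(\frac{2\sqrt{3}-3}{6}\right)\frac{2^{3n-2}}{\sqrt{\pi n^3}}.$$
   Context: A bracketed implication with $n$ distinct variables is a formula obtained from $p_1\to p_2\to\cdots\to p_n$ (variables in this fixed order) by fully inserting brackets; for $n\ge2$ it has the form $\psi\to\phi$ with $\psi$ a bracketing of $p_1\to\cdots\to p_i$ and $\phi$ a bracketing of $p_{i+1}\to\cdots\to p_n$ for some $1\le i\le n-1$. A row is a pair consisting of a bracketed formula and a valuation of $p_1,\dots,p_n$ in $\{0,1\}$ (0 = false, 1 = true). Case 3 means: for $n\ge 2$, $t_n^{\#3}$ counts the rows (over all bracketed implications in $n$ variables) for which $\psi$ and $\phi$ both have value 0 (so that $\psi\to\phi$ is true). $u_n\sim v_n$ means $u_n/v_n\to1$. *)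

theory Defs
  imports
    Complex_Main
    "HOL-Library.FuncSet"
    "HOL-Library.Landau_Symbols"
begin

datatype formula = Var nat | Imp formula formula

primrec var_list :: "formula \<Rightarrow> nat list" where
  "var_list (Var i) = [i]"
| "var_list (Imp \<psi> \<phi>) = var_list \<psi> @ var_list \<phi>"

primrec truth_value :: "(nat \<Rightarrow> bool) \<Rightarrow> formula \<Rightarrow> bool" where
  "truth_value v (Var i) = v i"
| "truth_value v (Imp \<psi> \<phi>) = (truth_value v \<psi> \<longrightarrow> truth_value v \<phi>)"

text \<open>A full bracketing of \<open>p\<^sub>1 \<rightarrow> p\<^sub>2 \<rightarrow> \<dots> \<rightarrow> p\<^sub>n\<close> is an implication tree whose leaves,
  read from left to right, are \<open>p\<^sub>1, \<dots>, p\<^sub>n\<close>.\<close>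

definition bracketings :: "nat \<Rightarrow> formula set" where
  "bracketings n = {F. var_list F = [1..<Suc n]}"

text \<open>Valuations of \<open>p\<^sub>1, \<dots>, p\<^sub>n\<close> are extensional functions (undefined outside \<open>{1..n}\<close>),
  so that there are exactly \<open>2 ^ n\<close> of them.\<close>

definition valuations :: "nat \<Rightarrow> (nat \<Rightarrow> bool) set" where
  "valuations n = {1..n} \<rightarrow>\<^sub>E UNIV"

definition rows :: "nat \<Rightarrow> (formula \<times> (nat \<Rightarrow> bool)) set" where
  "rows n = bracketings n \<times> valuations n"

definition case3_rows :: "nat \<Rightarrow> (formula \<times> (nat \<Rightarrow> bool)) set" where
  "case3_rows n = {(F, v) \<in> rows n.
     \<exists>\<psi> \<phi>. F = Imp \<psi> \<phi> \<and> \<not> truth_value v \<psi> \<and> \<not> truth_value v \<phi>}"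

definition t3 :: "nat \<Rightarrow> nat" where
  "t3 n = card (case3_rows n)"

lemma var_list_nonempty: "var_list F \<noteq> []"
  by (induction F) auto

lemma finite_var_list: "finite {F. var_list F = xs}"
proof (induction xs rule: length_induct)
  case (1 xs)
  let ?S = "\<lambda>ys. {F. var_list F = ys}"
  let ?D = "{k. 0 < k \<and> k < length xs}"
  have "?S xs \<subseteq> Var ` set xs \<union>
      (\<Union>k\<in>?D. (\<lambda>(\<psi>, \<phi>). Imp \<psi> \<phi>) ` (?S (take k xs) \<times> ?S (drop k xs)))"
  proof
    fix F assume F: "F \<in> ?S xs"
    show "F \<in> Var ` set xs \<union>
      (\<Union>k\<in>?D. (\<lambda>(\<psi>, \<phi>). Imp \<psi> \<phi>) ` (?S (take k xs) \<times> ?S (drop k xs)))"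
    proof (cases F)
      case (Var i)
      then show ?thesis using F by auto
    next
      case (Imp \<psi> \<phi>)
      let ?k = "length (var_list \<psi>)"
      have "xs = var_list \<psi> @ var_list \<phi>" using F Imp by auto
      then have "?k \<in> ?D" "\<psi> \<in> ?S (take ?k xs)" "\<phi> \<in> ?S (drop ?k xs)"
        using var_list_nonempty by auto
      then show ?thesis using Imp by blast
    qed
  qed
  moreover have "finite (\<Union>k\<in>?D. (\<lambda>(\<psi>, \<phi>). Imp \<psi> \<phi>) ` (?S (take k xs) \<times> ?S (drop k xs)))"
    using 1 by (intro finite_UN_I finite_imageI finite_cartesian_product) auto
  ultimately show ?case by (meson finite_UnI finite_imageI finite_set finite_subset)
qed

lemma finite_rows: "finite (rows n)"
  by (simp add: rows_def bracketings_def valuations_def finite_var_list finite_PiE)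

end

theory Submission
  imports Defs "HOL-Analysis.Analysis" "HOL-Real_Asymp.Real_Asymp"
begin

text \<open>
  Let \<open>F\<close> and \<open>G\<close> be the generating functions of the false rows and of all rows. Splitting an
  implication at its main arrow gives \<open>G = 2x + G\<^sup>2\<close> and \<open>F = x + (G - F) F\<close>, and the case 3 rows
  are counted by \<open>F\<^sup>2\<close>. Eliminating \<open>x\<close> yields \<open>F\<^sup>2 = H(G)\<close> with
  \<open>H(z) = (1 - z) (1 - sqrt (1 - z\<^sup>2)) / 2\<close>, which is analytic in the unit disc, whereas \<open>G = 1/2\<close> at
  the dominant singularity \<open>x = 1/8\<close>. The coefficients of \<open>G\<^sup>k\<close> are scaled ballot numbers, so that
  \<open>[x\<^sup>n] G\<^sup>k / [x\<^sup>n] G\<close> tends to \<open>k / 2\<^bsup>k-1\<^esup>\<close> and is bounded by it. By Tannery's theorem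
  \<open>[x\<^sup>n] H(G) / [x\<^sup>n] G\<close> tends to \<open>H'(1/2) = (2 sqrt 3 - 3) / 6\<close>, and \<open>[x\<^sup>n] G\<close> is
  \<open>2\<^sup>n\<close> times a Catalan number.
\<close>

unbundle no vec_syntax
unbundle fps_syntax

section \<open>Counting rows by the value of the formula\<close>

text \<open>Leaves range over an arbitrary list instead of \<open>1, ..., n\<close>, because the two
  sides of the main arrow carry a prefix and a suffix of the leaves.\<close>

definition val_rows :: "bool \<Rightarrow> nat list \<Rightarrow> (formula \<times> (nat \<Rightarrow> bool)) set" where
  "val_rows b xs = {(F, v). var_list F = xs \<and> v \<in> set xs \<rightarrow>\<^sub>E UNIV \<and> truth_value v F = b}"

definition imp_rows :: "bool \<Rightarrow> bool \<Rightarrow> nat list \<Rightarrow> (formula \<times> (nat \<Rightarrow> bool)) set" where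
  "imp_rows b c xs = {(F, v). var_list F = xs \<and> v \<in> set xs \<rightarrow>\<^sub>E UNIV \<and>
     (\<exists>\<psi> \<phi>. F = Imp \<psi> \<phi> \<and> truth_value v \<psi> = b \<and> truth_value v \<phi> = c)}"

lemma truth_value_cong:
  "(\<And>i. i \<in> set (var_list F) \<Longrightarrow> u i = v i) \<Longrightarrow> truth_value u F = truth_value v F"
  by (induction F) auto

lemma finite_val_rows: "finite (val_rows b xs)"
proof (rule finite_subset)
  show "val_rows b xs \<subseteq> {F. var_list F = xs} \<times> (set xs \<rightarrow>\<^sub>E UNIV)"
    by (auto simp: val_rows_def)
qed (simp add: finite_var_list finite_PiE)

lemma finite_imp_rows: "finite (imp_rows b c xs)"
proof (rule finite_subset)
  show "imp_rows b c xs \<subseteq> {F. var_list F = xs} \<times> (set xs \<rightarrow>\<^sub>E UNIV)"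
    by (auto simp: imp_rows_def)
qed (simp add: finite_var_list finite_PiE)

text \<open>Cutting at the main arrow, \<open>k\<close> is the number of leaves of the antecedent.
  Since \<open>xs\<close> is distinct, the two sides share no variable, so a valuation of
  \<open>xs\<close> amounts to an independent choice of one valuation per side.\<close>

lemma bij_betw_imp_rows:
  assumes "distinct xs"
  shows "bij_betw
     (\<lambda>(F, v). case F of Imp \<psi> \<phi> \<Rightarrow> (length (var_list \<psi>),
        (\<psi>, restrict v (set (var_list \<psi>))), (\<phi>, restrict v (set (var_list \<phi>)))))
     (imp_rows b c xs)
     (SIGMA k:{0<..<length xs}. val_rows b (take k xs) \<times> val_rows c (drop k xs))"
    (is "bij_betw ?f ?A ?B")
proof (rule bij_betw_byWitness)
  \<comment> \<open>The inverse map: join the formulas and glue the two valuations.\<close>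
  define g :: "nat \<times> (formula \<times> (nat \<Rightarrow> bool)) \<times> (formula \<times> (nat \<Rightarrow> bool)) \<Rightarrow> _"
    where "g = (\<lambda>(k, (\<psi>, u), (\<phi>, w)). (Imp \<psi> \<phi>, \<lambda>i. if i \<in> set (var_list \<psi>) then u i else w i))"
  have split: False if "i \<in> set (take k xs)" "i \<in> set (drop k xs)" for i k
    using that set_take_disj_set_drop_if_distinct[OF assms, of k k] by auto
  show "\<forall>r\<in>?A. g (?f r) = r"
    by (auto simp: imp_rows_def g_def PiE_def extensional_def restrict_def fun_eq_iff)
  show "\<forall>s\<in>?B. ?f (g s) = s"
    using split
    by (auto simp: val_rows_def g_def PiE_def extensional_def restrict_def fun_eq_iff)
  show "?f ` ?A \<subseteq> ?B"
  proof safe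
    fix F v k \<psi> u \<phi> w
    assume r: "(F, v) \<in> imp_rows b c xs"
      and eq: "(k, (\<psi>, u), (\<phi>, w)) = (case F of Imp \<psi> \<phi> \<Rightarrow> (length (var_list \<psi>),
        (\<psi>, restrict v (set (var_list \<psi>))), (\<phi>, restrict v (set (var_list \<phi>)))))"
    from r obtain \<psi>' \<phi>' where F: "F = Imp \<psi>' \<phi>'"
      and tv: "truth_value v \<psi>' = b" "truth_value v \<phi>' = c"
      and xs: "xs = var_list \<psi>' @ var_list \<phi>'"
      by (auto simp: imp_rows_def)
    have *: "truth_value (restrict v (set (var_list \<psi>'))) \<psi>' = b"
            "truth_value (restrict v (set (var_list \<phi>'))) \<phi>' = c"
      using tv by (auto cong: truth_value_cong)
    from eq F * xs var_list_nonempty[of \<psi>'] var_list_nonempty[of \<phi>']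
    show "k \<in> {0<..<length xs}" "(\<psi>, u) \<in> val_rows b (take k xs)" "(\<phi>, w) \<in> val_rows c (drop k xs)"
      by (auto simp: val_rows_def)
  qed
  show "g ` ?B \<subseteq> ?A"
  proof safe
    fix F v k \<psi> u \<phi> w
    assume eq: "(F, v) = g (k, (\<psi>, u), (\<phi>, w))"
      and k: "k \<in> {0<..<length xs}"
      and \<psi>: "(\<psi>, u) \<in> val_rows b (take k xs)" and \<phi>: "(\<phi>, w) \<in> val_rows c (drop k xs)"
    from eq have F: "F = Imp \<psi> \<phi>" and v: "v = (\<lambda>i. if i \<in> set (var_list \<psi>) then u i else w i)"
      by (auto simp: g_def)
    have vl: "var_list \<psi> = take k xs" "var_list \<phi> = drop k xs"
      using \<psi> \<phi> by (auto simp: val_rows_def)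
    have "truth_value v \<psi> = truth_value u \<psi>"
      by (rule truth_value_cong) (simp add: v)
    moreover have "truth_value v \<phi> = truth_value w \<phi>"
      by (rule truth_value_cong) (use split in \<open>auto simp: v vl\<close>)
    moreover have "v \<in> set (take k xs @ drop k xs) \<rightarrow>\<^sub>E UNIV"
      using \<psi> \<phi> unfolding v vl set_append by (auto simp: val_rows_def PiE_def extensional_def)
    ultimately show "(F, v) \<in> imp_rows b c xs"
      using \<psi> \<phi> by (auto simp: F imp_rows_def val_rows_def)
  qed
qed

lemma card_imp_rows:
  assumes "distinct xs"
  shows "card (imp_rows b c xs) =
    (\<Sum>k\<in>{0<..<length xs}. card (val_rows b (take k xs)) * card (val_rows c (drop k xs)))"
  using bij_betw_same_card[OF bij_betw_imp_rows[OF assms, of b c]]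
  by (simp add: card_cartesian_product finite_val_rows)

lemma card_var_rows: "card {(F, v). var_list F = xs \<and> v \<in> set xs \<rightarrow>\<^sub>E UNIV \<and>
    (\<exists>i. F = Var i \<and> v i = b)} = (if length xs = 1 then 1 else 0)"
proof (cases "length xs = 1")
  case True
  then obtain x where "xs = [x]" by (auto simp: length_Suc_conv)
  then have "{(F, v). var_list F = xs \<and> v \<in> set xs \<rightarrow>\<^sub>E UNIV \<and> (\<exists>i. F = Var i \<and> v i = b)} =
     {(Var x, \<lambda>i\<in>{x}. b)}"
    by (auto simp: PiE_def extensional_def fun_eq_iff)
  then show ?thesis using True by simp
next
  case False
  then have empty: "{(F, v). var_list F = xs \<and> v \<in> set xs \<rightarrow>\<^sub>E UNIV \<and> (\<exists>i. F = Var i \<and> v i = b)} = {}"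
    by auto
  show ?thesis unfolding empty using False by simp
qed

lemma finite_var_rows: "finite {(F, v). var_list F = xs \<and> v \<in> set xs \<rightarrow>\<^sub>E UNIV \<and>
    (\<exists>i. F = Var i \<and> v i = (b :: bool))}"
  by (rule finite_subset[OF _ finite_val_rows[of b xs]]) (auto simp: val_rows_def)

lemma card_val_rows_False:
  "card (val_rows False xs) = (if length xs = 1 then 1 else 0) + card (imp_rows True False xs)"
proof -
  let ?V = "{(F, v). var_list F = xs \<and> v \<in> set xs \<rightarrow>\<^sub>E UNIV \<and> (\<exists>i. F = Var i \<and> v i = False)}"
  have "val_rows False xs = ?V \<union> imp_rows True False xs"
  proof (rule set_eqI, clarify)
    fix F v show "(F, v) \<in> val_rows False xs \<longleftrightarrow> (F, v) \<in> ?V \<union> imp_rows True False xs"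
      by (cases F) (auto simp: val_rows_def imp_rows_def)
  qed
  moreover have "?V \<inter> imp_rows True False xs = {}"
    by (auto simp: imp_rows_def)
  ultimately show ?thesis
    using finite_var_rows[of xs False] card_var_rows[of xs False]
    by (simp add: card_Un_disjoint finite_imp_rows)
qed

lemma card_val_rows_True:
  "card (val_rows True xs) = (if length xs = 1 then 1 else 0) +
     (card (imp_rows False False xs) + card (imp_rows False True xs) + card (imp_rows True True xs))"
proof -
  let ?V = "{(F, v). var_list F = xs \<and> v \<in> set xs \<rightarrow>\<^sub>E UNIV \<and> (\<exists>i. F = Var i \<and> v i = True)}"
  have "val_rows True xs =
     ?V \<union> (imp_rows False False xs \<union> imp_rows False True xs \<union> imp_rows True True xs)"
  proof (rule set_eqI, clarify)
    fix F v show "(F, v) \<in> val_rows True xs \<longleftrightarrow> (F, v) \<in>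
      ?V \<union> (imp_rows False False xs \<union> imp_rows False True xs \<union> imp_rows True True xs)"
      by (cases F) (auto simp: val_rows_def imp_rows_def)
  qed
  moreover have "?V \<inter> (imp_rows False False xs \<union> imp_rows False True xs \<union> imp_rows True True xs) = {}"
    "imp_rows False False xs \<inter> imp_rows False True xs = {}"
    "(imp_rows False False xs \<union> imp_rows False True xs) \<inter> imp_rows True True xs = {}"
    by (auto simp: imp_rows_def)
  ultimately show ?thesis
    using finite_var_rows[of xs True] card_var_rows[of xs True]
    by (simp add: card_Un_disjoint finite_imp_rows)
qed

text \<open>Names of variables do not matter. Only proper segments of the list enter
  \<open>card_imp_rows\<close>, hence induction on the length. This turns the counts into functions
  of one number, ready for generating functions.\<close>

lemma card_val_rows_cong:
  assumes "length xs = length ys" "distinct xs" "distinct ys"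
  shows "card (val_rows b xs) = card (val_rows b ys)"
  using assms
proof (induction "length xs" arbitrary: b xs ys rule: less_induct)
  case less
  have "card (imp_rows c d xs) = card (imp_rows c d ys)" for c d
    unfolding card_imp_rows[OF less.prems(2)] card_imp_rows[OF less.prems(3)] less.prems(1)
    by (intro sum.cong refl arg_cong2[where f = "(*)"] less.hyps) (use less.prems in auto)
  then show ?case
    using less.prems(1) by (cases b) (simp_all add: card_val_rows_True card_val_rows_False)
qed

section \<open>Generating functions of the rows with a given value\<close>

definition row_fps :: "bool \<Rightarrow> real fps" where
  "row_fps b = Abs_fps (\<lambda>n. real (card (val_rows b [1..<Suc n])))"

lemma row_fps_nth: "distinct xs \<Longrightarrow> row_fps b $ length xs = real (card (val_rows b xs))"
  using card_val_rows_cong[of xs "[1..<Suc (length xs)]" b] by (simp add: row_fps_def del: upt_Suc)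

lemma row_fps_nth_0 [simp]: "row_fps b $ 0 = 0"
  by (simp add: row_fps_def val_rows_def var_list_nonempty)

text \<open>The cut at the main arrow is a Cauchy product; its two extreme terms vanish because no
  formula has an empty list of leaves.\<close>

lemma imp_rows_fps_nth:
  assumes "distinct xs"
  shows "(row_fps b * row_fps c) $ length xs = real (card (imp_rows b c xs))"
proof -
  have "(row_fps b * row_fps c) $ length xs =
      (\<Sum>k\<in>{0..length xs}. row_fps b $ k * row_fps c $ (length xs - k))"
    by (simp add: fps_mult_nth)
  also have "\<dots> = (\<Sum>k\<in>{0<..<length xs}. row_fps b $ k * row_fps c $ (length xs - k))"
    by (rule sum.mono_neutral_right) (auto simp: not_less)
  also have "\<dots> = real (card (imp_rows b c xs))"
    unfolding card_imp_rows[OF assms] of_nat_sum of_nat_mult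
  proof (intro sum.cong refl arg_cong2[where f = "(*)"])
    fix k assume "k \<in> {0<..<length xs}"
    then show "row_fps b $ k = real (card (val_rows b (take k xs)))"
      using assms row_fps_nth[of "take k xs" b] by simp
    show "row_fps c $ (length xs - k) = real (card (val_rows c (drop k xs)))"
      using assms row_fps_nth[of "drop k xs" c] by simp
  qed
  finally show ?thesis .
qed

text \<open>An implication is false exactly when its antecedent is true and its succedent false;
  \<open>fps_X\<close> is the single variable with value false.\<close>

lemma row_fps_False: "row_fps False = fps_X + row_fps True * row_fps False"
proof (rule fps_ext)
  fix n
  show "row_fps False $ n = (fps_X + row_fps True * row_fps False) $ n"
    using row_fps_nth[of "[1..<Suc n]" False] imp_rows_fps_nth[of "[1..<Suc n]" True False]
    by (simp add: card_val_rows_False fps_X_def del: upt_Suc)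
qed

lemma row_fps_True: "row_fps True = fps_X +
  (row_fps False * row_fps False + row_fps False * row_fps True + row_fps True * row_fps True)"
proof (rule fps_ext)
  fix n
  show "row_fps True $ n = (fps_X + (row_fps False * row_fps False + row_fps False * row_fps True
      + row_fps True * row_fps True)) $ n"
    using row_fps_nth[of "[1..<Suc n]" True] imp_rows_fps_nth[of "[1..<Suc n]" False False]
      imp_rows_fps_nth[of "[1..<Suc n]" False True] imp_rows_fps_nth[of "[1..<Suc n]" True True]
    by (simp add: card_val_rows_True fps_X_def del: upt_Suc)
qed

lemma t3_eq_fps_nth: "real (t3 n) = (row_fps False * row_fps False) $ n"
proof -
  have "set [1..<Suc n] = {1..n}" by auto
  then have "case3_rows n = imp_rows False False [1..<Suc n]"
    by (auto simp: case3_rows_def Defs.rows_def bracketings_def valuations_def imp_rows_def simp del: upt_Suc)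
  then show ?thesis
    using imp_rows_fps_nth[of "[1..<Suc n]" False False] by (simp add: t3_def del: upt_Suc)
qed

section \<open>Ballot numbers\<close>

text \<open>The induction runs over \<open>m\<close> first and \<open>k\<close> second: both recursive terms then carry the same factor \<open>2 m + k\<close>.\<close>
lemma fps_power_nth_closed_form:
  fixes G :: "real fps"
  assumes G0: "G $ 0 = 0" and G: "G = 2 * fps_X + G\<^sup>2"
  shows "real (2 * m + k) * (G ^ k) $ (m + k) = 2 ^ (m + k) * real k * real ((2 * m + k) choose m)"
proof -
  have expand: "G ^ Suc k = 2 * (fps_X * G ^ k) + G ^ (k + 2)" for k
  proof -
    have "G ^ Suc k = (2 * fps_X + G\<^sup>2) * G ^ k" using G by simp
    then show ?thesis by (simp add: algebra_simps power2_eq_square)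
  qed
  \<comment> \<open>For coefficients indexed by \<open>m + k\<close>, the first summand lowers the
    power and keeps \<open>m\<close>, while the second lowers \<open>m\<close> by one and raises the
    power.\<close>
  have rec: "(G ^ Suc k) $ Suc n = 2 * (G ^ k) $ n + (G ^ (k + 2)) $ Suc n" for k n
    unfolding expand[of k] by (simp add: numeral_fps_const del: power_Suc)
  have zero: "(G ^ k) $ n = 0" if "n < k" for n k
    using startsby_zero_power_prefix[OF G0, of k] that by simp
  \<comment> \<open>The base case \<open>m = 0\<close>: \<open>G\<close> begins with
    \<open>2x\<close>.\<close>
  have diag: "(G ^ k) $ k = 2 ^ k" for k
  proof (induction k)
    case (Suc k)
    then show ?case using rec[of k k] zero[of "Suc k" "k + 2"] by (simp del: power_Suc add: power_Suc[of 2])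
  qed simp
  show ?thesis
  proof (induction m arbitrary: k)
    case 0
    show ?case using diag by simp
  next
    case (Suc m)
    note IHm = Suc
    show ?case
    proof (induction k)
      case 0
      show ?case by simp
    next
      case (Suc k)
      \<comment> \<open>\<open>N\<close> is the value of \<open>2 m + k\<close> shared by both
        recursive terms, and \<open>c\<close> is a common unit in which all three binomials are
        multiples.\<close>
      define N where "N = 2 * m + k + 2"
      define q where "q = (G ^ Suc k) $ (Suc m + Suc k)"
      define c where "c = real (N choose m) / real (m + 1)"
      have c1: "real (N choose m) = real (m + 1) * c"
        by (simp add: c_def)
      have "real (Suc m) * real (N choose Suc m) = real (N - m) * real (N choose m)"
        by (metis Suc_times_binomial_eq binomial_absorb_comp of_nat_mult mult.commute binomial_absorption)
      then have c2: "real (N choose Suc m) = real (m + k + 2) * c"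
        by (simp add: c_def N_def field_simps)
      have c3: "real (Suc N choose Suc m) = real (N + 1) * c"
      proof -
        have "real (Suc N choose Suc m) = real (N choose m) + real (N choose Suc m)"
          by simp
        also have "\<dots> = real (N + 1) * c"
          unfolding c1 c2 by (simp add: N_def algebra_simps)
        finally show ?thesis .
      qed
      have "real N * q = 2 * (real N * (G ^ k) $ (Suc m + k)) + real N * (G ^ (k + 2)) $ (m + (k + 2))"
        using rec[of k "Suc m + k"] by (simp add: q_def algebra_simps)
      also have "real N * (G ^ k) $ (Suc m + k) = 2 ^ (Suc m + k) * real k * real (N choose Suc m)"
        using Suc by (simp add: N_def)
      also have "real N * (G ^ (k + 2)) $ (m + (k + 2)) = 2 ^ (m + k + 2) * real (k + 2) * real (N choose m)"
        using IHm[of "k + 2"] by (simp add: N_def add_ac)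
      finally have "real N * q = 2 ^ (m + k + 2) * c * (real k * real (m + k + 2) + real (k + 2) * real (m + 1))"
        unfolding c1 c2 by (simp add: algebra_simps)
      \<comment> \<open>This factorisation lets the positive factor \<open>N\<close> cancel.\<close>
      also have "real k * real (m + k + 2) + real (k + 2) * real (m + 1) = real N * real (k + 1)"
        by (simp add: N_def algebra_simps)
      finally have "real N * q = real N * (2 ^ (m + k + 2) * c * real (k + 1))" by (simp only: mult_ac)
      then have "q = 2 ^ (m + k + 2) * c * real (k + 1)"
        by (simp add: N_def)
      then have "real (N + 1) * q = 2 ^ (m + k + 2) * real (k + 1) * real (Suc N choose Suc m)"
        unfolding c3 by simp
      moreover have "2 * Suc m + Suc k = N + 1" by (simp add: N_def)
      ultimately show ?case unfolding q_def by (simp add: N_def)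
    qed
  qed
qed

section \<open>The outer power series\<close>

text \<open>The series of sqrt(1 - x^2), written as (1 + x)^(1/2) times (1 - x)^(1/2), so that
  radius and values come from the binomial series at z and -z.\<close>

definition bin_sqrt :: "real fps" where
  "bin_sqrt = fps_binomial (1/2) * (fps_binomial (1/2) oo (- fps_X))"

lemma bin_sqrt_sq: "bin_sqrt\<^sup>2 = 1 - fps_X\<^sup>2"
proof -
  have 1: "fps_binomial (1/2) * fps_binomial (1/2) = (1 + fps_X :: real fps)"
    unfolding fps_binomial_add_mult[symmetric] using fps_binomial_1 by simp
  have "bin_sqrt\<^sup>2 = (fps_binomial (1/2) * fps_binomial (1/2)) *
     ((fps_binomial (1/2) * fps_binomial (1/2)) oo (- fps_X))"
    by (subst fps_compose_mult_distrib) (simp_all add: bin_sqrt_def power2_eq_square mult_ac)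
  also have "\<dots> = (1 + fps_X) * (1 - fps_X)"
    unfolding 1 by (simp add: fps_compose_add_distrib)
  finally show ?thesis by (simp add: algebra_simps power2_eq_square)
qed

lemma bin_sqrt_0: "bin_sqrt $ 0 = 1"
  by (simp add: bin_sqrt_def)

lemma conv_radius_bin_sqrt: "fps_conv_radius bin_sqrt \<ge> 1"
  and eval_bin_sqrt: "\<bar>z\<bar> < 1 \<Longrightarrow> eval_fps bin_sqrt z = sqrt (1 - z\<^sup>2)"
proof -
  let ?B = "fps_binomial (1/2) :: real fps"
  \<comment> \<open>For a natural exponent the binomial series is a polynomial; otherwise its radius
    is 1.\<close>
  have half: "(1/2 :: real) \<notin> \<nat>"
  proof
    assume "(1/2 :: real) \<in> \<nat>"
    then obtain n where "1 / 2 = real n" by (auto elim: Nats_cases)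
    then have "real 1 = real (2 * n)" by simp
    then have "1 = 2 * n" by (simp only: of_nat_eq_iff)
    then show False by presburger
  qed
  have r1: "fps_conv_radius ?B = 1"
    by (simp add: fps_conv_radius_def conv_radius_gchoose half)
  have "fps_conv_radius (?B oo (- fps_X)) = fps_conv_radius ?B"
    unfolding fps_compose_uminus'
    \<comment> \<open>The radius depends only on the absolute values of the coefficients, which x ->
      -x preserves.\<close>
    by (subst (1 2) fps_conv_radius_norm[symmetric]) (simp add: abs_mult)
  then have r2: "fps_conv_radius (?B oo (- fps_X)) = 1"
    using r1 by simp
  show "fps_conv_radius bin_sqrt \<ge> 1"
    unfolding bin_sqrt_def using fps_conv_radius_mult[of ?B "?B oo (- fps_X)"] r1 r2 by simp
  assume z: "\<bar>z\<bar> < 1"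
  have e1: "eval_fps ?B z = sqrt (1 + z)" if "\<bar>z\<bar> < 1" for z
    using gen_binomial_real[OF that, of "1/2"] that
    by (simp add: eval_fps_def sums_iff powr_half_sqrt)
  have "eval_fps (?B oo (- fps_X)) z = eval_fps ?B (- z)"
    unfolding eval_fps_def fps_compose_uminus'
    by (intro suminf_cong) (simp add: power_minus[of z])
  then have "eval_fps bin_sqrt z = sqrt (1 + z) * sqrt (1 - z)"
    unfolding bin_sqrt_def using z r1 r2 e1[of z] e1[of "-z"]
    by (subst eval_fps_mult) simp_all
  then show "eval_fps bin_sqrt z = sqrt (1 - z\<^sup>2)"
    by (simp add: real_sqrt_mult[symmetric] algebra_simps power2_eq_square)
qed

text \<open>The expansion at 0 of the function \<open>H\<close> from the overview.\<close>

definition outer_fps :: "real fps" where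
  "outer_fps = fps_const (1/2) * ((1 - fps_X) * (1 - bin_sqrt))"

lemma conv_radius_outer_fps: "fps_conv_radius outer_fps \<ge> 1"
  and eval_outer_fps: "\<bar>z\<bar> < 1 \<Longrightarrow> eval_fps outer_fps z = 1 / 2 * ((1 - z) * (1 - sqrt (1 - z\<^sup>2)))"
proof -
  have a: "fps_conv_radius (1 - fps_X :: real fps) = \<infinity>"
    using fps_conv_radius_diff[of "1 :: real fps" fps_X] by simp
  have b: "fps_conv_radius (1 - bin_sqrt) \<ge> 1"
    using fps_conv_radius_diff[of 1 bin_sqrt] conv_radius_bin_sqrt by simp
  have c: "fps_conv_radius ((1 - fps_X) * (1 - bin_sqrt)) \<ge> 1"
    using fps_conv_radius_mult[of "1 - fps_X" "1 - bin_sqrt"] a b by simp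
  show "fps_conv_radius outer_fps \<ge> 1"
    unfolding outer_fps_def
    using fps_conv_radius_mult[of "fps_const (1/2)" "(1 - fps_X) * (1 - bin_sqrt)"] c by simp
  assume "\<bar>z\<bar> < 1"
  then have z: "ereal (norm z) < 1" by simp
  show "eval_fps outer_fps z = 1 / 2 * ((1 - z) * (1 - sqrt (1 - z\<^sup>2)))"
    unfolding outer_fps_def
    using \<open>\<bar>z\<bar> < 1\<close> less_le_trans[OF z conv_radius_bin_sqrt] less_le_trans[OF z b] less_le_trans[OF z c] a
    by (simp add: eval_fps_mult eval_fps_diff eval_bin_sqrt)
qed

text \<open>Near 1/2 the series equals its closed form, whose derivative there is computed by the
  usual rules; derivatives are unique.\<close>

lemma eval_deriv_outer_fps: "eval_fps (fps_deriv outer_fps) (1/2) = (2 * sqrt 3 - 3) / 6"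
proof (rule DERIV_unique)
  have "ereal (norm (1/2 :: real)) < 1" by simp
  from less_le_trans[OF this conv_radius_outer_fps]
  show "(eval_fps outer_fps has_field_derivative eval_fps (fps_deriv outer_fps) (1/2)) (at (1/2))"
    by (rule has_field_derivative_eval_fps)
  have s: "sqrt (3 / 4) = sqrt 3 / 2"
    by (simp add: real_sqrt_divide)
  have sqrt: "((\<lambda>z :: real. sqrt (1 - z\<^sup>2)) has_field_derivative - 1 / sqrt 3) (at (1/2))"
    by (auto intro!: derivative_eq_intros simp: power2_eq_square s field_simps)
  have "((\<lambda>z. 1 / 2 * ((1 - z) * (1 - sqrt (1 - z\<^sup>2)))) has_field_derivative (2 * sqrt 3 - 3) / 6) (at (1/2))"
    by (rule derivative_eq_intros sqrt refl)+ (simp add: power2_eq_square s field_simps)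
  then show "(eval_fps outer_fps has_field_derivative (2 * sqrt 3 - 3) / 6) (at (1/2))"
    by (rule has_field_derivative_transform_within_open[where S = "{-1<..<1}"])
       (auto simp: eval_outer_fps)
qed

text \<open>The constant coefficient of \<open>A + B\<close> is 2, and formal power series over the
  reals have no zero divisors. This fixes the branch of the square root.\<close>

lemma fps_square_eq_imp:
  fixes A B :: "real fps"
  assumes "A\<^sup>2 = B\<^sup>2" "A $ 0 = 1" "B $ 0 = 1"
  shows "A = B"
proof -
  have "(A - B) * (A + B) = 0"
    using assms(1) by (simp add: algebra_simps power2_eq_square)
  moreover have "(A + B) $ 0 \<noteq> 0" using assms by simp
  then have "A + B \<noteq> 0" by (metis fps_zero_nth)
  ultimately show ?thesis by simp
qed

lemma fps_square_eq_compose: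
  fixes F G :: "real fps"
  assumes "F $ 0 = 0" "G $ 0 = 0"
    and G: "G = 2 * fps_X + G\<^sup>2" and F: "F = fps_X + (G - F) * F"
  shows "F * F = outer_fps oo G"
proof -
  \<comment> \<open>\<open>S\<close> is the root of the discriminant of F^2 + (1 - G) F = x: with 2x
    = G - G^2 the discriminant (1 - G)^2 + 4x becomes 1 - G^2.\<close>
  define S where "S = 2 * F + 1 - G"
  have "S\<^sup>2 = 1 - G\<^sup>2"
    using F G unfolding S_def by algebra
  also have "\<dots> = (1 - fps_X\<^sup>2) oo G"
    using assms by (simp add: fps_compose_sub_distrib flip: fps_compose_power)
  also have "\<dots> = (bin_sqrt oo G)\<^sup>2"
    using assms by (simp add: bin_sqrt_sq fps_compose_power)
  finally have S: "S = bin_sqrt oo G"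
    by (rule fps_square_eq_imp) (use assms in \<open>simp_all add: S_def bin_sqrt_0\<close>)
  \<comment> \<open>Put x = G (1 - G) / 2 into F^2 = x - (1 - G) F and use G - 2F = 1 - S.\<close>
  have "2 * (F * F) = (1 - G) * (1 - S)"
    using F G unfolding S_def by algebra
  then have "fps_const (1/2) * (2 * (F * F)) = outer_fps oo G"
    using assms(2)
    by (simp add: S outer_fps_def fps_compose_mult_distrib fps_compose_sub_distrib)
  then show ?thesis
    by (simp add: numeral_fps_const flip: mult.assoc)
qed

section \<open>Coefficient asymptotics of compositions\<close>

lemma Suc_times_odd_binomial:
  "Suc m * (Suc (2 * m) choose m) = Suc (2 * m) * ((2 * m) choose m)"
proof -
  have "Suc (2 * m) - m = Suc m" by simp
  then have "Suc (2 * m) choose m = Suc (2 * m) choose Suc m"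
    using binomial_symmetric[of m "Suc (2 * m)"] by (simp del: binomial_Suc_Suc)
  then show ?thesis
    using Suc_times_binomial_eq[of "2 * m" m] by (simp del: binomial_Suc_Suc mult_Suc mult_Suc_right add: mult.commute)
qed

text \<open>Both sides satisfy the same first-order recurrence in \<open>m\<close>. The right-hand
  form gives access to the Gamma-function asymptotics of generalised binomials.\<close>

lemma central_binomial_eq_gbinomial:
  "real ((2 * m) choose m) = (-1) ^ m * 4 ^ m * ((-1/2) gchoose m)"
proof (induction m)
  case (Suc m)
  define x where "x = ((-1/2 :: real) gchoose m)"
  have g: "real (Suc m) * ((-1/2) gchoose Suc m) = (-1/2 - real m) * x"
    unfolding x_def gbinomial_absorption gbinomial_absorb_comp ..
  have "Suc m * (Suc m * ((2 * Suc m) choose Suc m)) = Suc m * (2 * (2 * m + 1) * ((2 * m) choose m))"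
  proof -
    have "Suc m * ((2 * Suc m) choose Suc m) = 2 * Suc m * (Suc (2 * m) choose m)"
    proof -
      have "2 * Suc m = Suc (Suc (2 * m))" by simp
      then show ?thesis using Suc_times_binomial_eq[of "Suc (2 * m)" m] by (metis mult.commute)
    qed
    then have "Suc m * (Suc m * ((2 * Suc m) choose Suc m)) = 2 * Suc m * (Suc m * (Suc (2 * m) choose m))"
      by (simp only: mult_ac)
    then show ?thesis
      unfolding Suc_times_odd_binomial by (simp only: mult_ac Suc_eq_plus1)
  qed
  then have "Suc m * ((2 * Suc m) choose Suc m) = 2 * (2 * m + 1) * ((2 * m) choose m)"
    by (simp only: mult_cancel1) simp
  then have "real (Suc m) * real ((2 * Suc m) choose Suc m) = real (2 * (2 * m + 1)) * real ((2 * m) choose m)"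
    by (metis of_nat_mult)
  also have "\<dots> = (-1) ^ Suc m * 4 ^ Suc m * ((-1/2 - real m) * x)"
    unfolding Suc.IH x_def[symmetric] by (simp add: algebra_simps)
  also have "\<dots> = real (Suc m) * ((-1) ^ Suc m * 4 ^ Suc m * ((-1/2) gchoose Suc m))"
    unfolding g[symmetric] by (simp only: mult_ac)
  finally show ?case by (simp only: mult_cancel_left of_nat_eq_0_iff) simp
qed simp

section \<open>Coefficients of powers of \<open>G\<close> relative to those of
  \<open>G\<close>\<close>

locale power_fps =
  fixes G :: "real fps"
  assumes G0: "G $ 0 = 0" and G: "G = 2 * fps_X + G\<^sup>2"
begin

lemma power_nth_nonneg: "(G ^ k) $ n \<ge> 0"
proof (cases "n < k \<or> k = 0")
  case True
  then show ?thesis using startsby_zero_power_prefix[OF G0, of k] by (auto simp: fps_one_nth)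
next
  case False
  then obtain m where n: "n = m + k" by (metis add.commute le_iff_add not_less)
  have "0 \<le> real (2 * m + k) * (G ^ k) $ n"
    unfolding n fps_power_nth_closed_form[OF G0 G] by (intro mult_nonneg_nonneg) simp_all
  then show ?thesis using False by (simp add: zero_le_mult_iff)
qed

text \<open>The quotient of two neighbouring closed forms, cleared of denominators. It yields both
  the bound and the limit of the ratios below.\<close>

lemma power_nth_Suc:
  assumes "k > 0"
  shows "(2 * real n - real k - 1) * real k * (G ^ Suc k) $ n
    = real (k + 1) * (real n - real k) * (G ^ k) $ n"
proof (cases "n \<le> k")
  \<comment> \<open>Both sides vanish: for \<open>n < k\<close> both coefficients are 0, and for
    \<open>n = k\<close> the right side has the factor \<open>n - k\<close>.\<close>
  case True
  then show ?thesis
    using startsby_zero_power_prefix[OF G0, of k] startsby_zero_power_prefix[OF G0, of "Suc k"]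
    by (cases "n = k") auto
next
  case False
  then obtain m where n: "n = Suc (m + k)" by (metis less_imp_Suc_add add.commute not_less)
  define N where "N = 2 * m + k + 1"
  have e1: "real N * (G ^ Suc k) $ n = 2 ^ n * real (k + 1) * real (N choose m)"
    using fps_power_nth_closed_form[OF G0 G, of m "Suc k"] by (simp add: N_def n del: power_Suc)
  have e2: "real (Suc N) * (G ^ k) $ n = 2 ^ n * real k * real (Suc N choose Suc m)"
    using fps_power_nth_closed_form[OF G0 G, of "Suc m" k] by (simp add: N_def n del: binomial_Suc_Suc)
  have e3: "real (Suc m) * real (Suc N choose Suc m) = real (Suc N) * real (N choose m)"
    by (metis Suc_times_binomial_eq mult.commute of_nat_mult)
  have "real (Suc N) * (real N * (G ^ Suc k) $ n * real k) =
      2 ^ n * real (k + 1) * real k * (real (Suc N) * real (N choose m))"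
    unfolding e1 by (simp only: mult_ac)
  also have "\<dots> = real (k + 1) * real (Suc m) * (2 ^ n * real k * real (Suc N choose Suc m))"
    unfolding e3[symmetric] by (simp only: mult_ac)
  also have "\<dots> = real (Suc N) * (real (k + 1) * real (Suc m) * (G ^ k) $ n)"
    unfolding e2[symmetric] by (simp only: mult_ac)
  finally have "real N * (G ^ Suc k) $ n * real k = real (k + 1) * real (Suc m) * (G ^ k) $ n"
    by (simp only: mult_cancel_left of_nat_eq_0_iff) simp
  moreover have "2 * real n - real k - 1 = real N" "real n - real k = real (Suc m)"
    by (simp_all add: n N_def)
  ultimately show ?thesis by (simp only: mult_ac)
qed

text \<open>For positive \<open>k\<close>, 2 (n - k) is at most 2n - k - 1, so passing from
  \<open>k\<close> to \<open>k + 1\<close> multiplies the coefficient by at most (k + 1) /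
  (2k).\<close>

lemma power_nth_bound:
  assumes "k > 0"
  shows "(G ^ k) $ n \<le> real k * (1/2) ^ (k - 1) * G $ n"
  using assms
proof (induction k rule: nat_induct_non_zero)
  case 1
  show ?case by simp
next
  case (Suc k)
  show ?case
  proof (cases "n \<le> k")
    case True
    then have "(G ^ Suc k) $ n = 0"
      using startsby_zero_power_prefix[OF G0, of "Suc k"] by auto
    then show ?thesis using power_nth_nonneg[of 1 n] by simp
  next
    case False
    define D where "D = 2 * real n - real k - 1"
    have D: "D > 0" "2 * (real n - real k) \<le> D" using False Suc by (auto simp: D_def)
    have "D * (2 * (real k * (G ^ Suc k) $ n)) = real (k + 1) * (2 * (real n - real k)) * (G ^ k) $ n"
      using power_nth_Suc[OF Suc.hyps, of n] by (simp add: D_def algebra_simps)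
    also have "\<dots> \<le> real (k + 1) * D * (G ^ k) $ n"
      by (intro mult_right_mono mult_left_mono D power_nth_nonneg) simp
    also have "\<dots> = D * (real (k + 1) * (G ^ k) $ n)" by simp
    finally have "2 * (real k * (G ^ Suc k) $ n) \<le> real (k + 1) * (G ^ k) $ n"
      using D by (simp only: mult_le_cancel_left_pos)
    also have "\<dots> \<le> real (k + 1) * (real k * (1/2) ^ (k - 1) * G $ n)"
      by (intro mult_left_mono Suc) simp
    also have "\<dots> = 2 * (real k * (real (Suc k) * (1/2) ^ (Suc k - 1) * G $ n))"
      using Suc.hyps by (cases k) (simp_all add: mult_ac)
    finally show ?thesis using Suc.hyps by simp
  qed
qed

text \<open>The closed form for \<open>k = 1\<close>, brought into Catalan shape.\<close>

lemma nth_Suc_eq: "real (m + 1) * G $ Suc m = 2 ^ (m + 1) * real ((2 * m) choose m)"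
proof -
  have "real (2 * m + 1) * G $ Suc m = 2 ^ (m + 1) * real ((2 * m + 1) choose m)"
    using fps_power_nth_closed_form[OF G0 G, of m 1] by simp
  moreover have "real (m + 1) * real ((2 * m + 1) choose m) = real (2 * m + 1) * real ((2 * m) choose m)"
  proof -
    have "(m + 1) * (Suc (2 * m) choose m) = Suc (2 * m) * ((2 * m) choose m)"
      using Suc_times_odd_binomial[of m] by simp
    then show ?thesis by (metis Suc_eq_plus1 of_nat_mult)
  qed
  ultimately have "real (2 * m + 1) * (real (m + 1) * G $ Suc m) =
      real (2 * m + 1) * (2 ^ (m + 1) * real ((2 * m) choose m))"
    by (metis mult.left_commute)
  then show ?thesis by (simp only: mult_cancel_left of_nat_eq_0_iff) simp
qed

lemma nth_pos:
  assumes "n > 0"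
  shows "G $ n > 0"
proof -
  obtain m where n: "n = Suc m" using assms gr0_implies_Suc by blast
  have "real (m + 1) * G $ n > 0"
    unfolding n nth_Suc_eq by simp
  then show ?thesis by (simp add: zero_less_mult_iff)
qed

text \<open>The step factor \<open>r n\<close> tends to (k + 1) / (2k). The resulting limit is the
  derivative of z^k at 1/2.\<close>

lemma power_nth_ratio_tendsto:
  assumes "k > 0"
  shows "(\<lambda>n. (G ^ k) $ n / G $ n) \<longlonglongrightarrow> real k * (1/2) ^ (k - 1)"
  using assms
proof (induction k rule: nat_induct_non_zero)
  case 1
  have "eventually (\<lambda>n. (G ^ 1) $ n / G $ n = real 1 * (1/2) ^ (1 - 1)) sequentially"
    using eventually_gt_at_top[of 0]
  proof eventually_elim
    case (elim n)
    then show ?case using nth_pos[of n] by simp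
  qed
  then show ?case by (rule tendsto_eventually)
next
  case (Suc k)
  define r where "r n = real (k + 1) / real k * ((real n - real k) / (2 * real n - real k - 1))" for n
  have r: "r \<longlonglongrightarrow> real (k + 1) / real k * (1/2)"
    unfolding r_def by (intro tendsto_mult tendsto_const) real_asymp
  have "(\<lambda>n. r n * ((G ^ k) $ n / G $ n)) \<longlonglongrightarrow> real (k + 1) / real k * (1/2) * (real k * (1/2) ^ (k - 1))"
    by (rule tendsto_mult[OF r Suc.IH])
  moreover have "real (k + 1) / real k * (1/2) * (real k * (1/2) ^ (k - 1)) = real (Suc k) * (1/2) ^ (Suc k - 1)"
  proof -
    have "real (k + 1) / real k * (1/2) * (real k * (1/2) ^ (k - 1)) = real (k + 1) * ((1/2) * (1/2) ^ (k - 1))"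
      using Suc.hyps by simp
    also have "(1/2) * (1/2) ^ (k - 1) = ((1/2) ^ k :: real)"
      using Suc.hyps by (cases k) simp_all
    finally show ?thesis by simp
  qed
  moreover have "eventually (\<lambda>n. r n * ((G ^ k) $ n / G $ n) = (G ^ Suc k) $ n / G $ n) sequentially"
    using eventually_gt_at_top[of k]
  proof eventually_elim
    case (elim n)
    define D where "D = 2 * real n - real k - 1"
    have D: "D > 0" using elim Suc.hyps by (simp add: D_def)
    have "(G ^ Suc k) $ n = r n * (G ^ k) $ n"
      using power_nth_Suc[OF Suc.hyps, of n] D Suc.hyps
      unfolding r_def D_def[symmetric] by (simp add: field_simps del: power_Suc)
    then show ?case by simp
  qed
  ultimately show ?case by (simp only: Lim_transform_eventually)
qed

text \<open>Each summand of the composition has as limit a coefficient of \<open>H\<close> times the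
  derivative of z^k at 1/2. The bound on the ratios dominates the summands uniformly in
  \<open>n\<close>, and the dominating series converges because 1/2 lies inside the disc of
  convergence of \<open>H\<close>.\<close>

lemma compose_nth_asymp:
  assumes "fps_conv_radius H > ereal (1/2)"
  shows "(\<lambda>n. (H oo G) $ n / G $ n) \<longlonglongrightarrow> eval_fps (fps_deriv H) (1/2)"
proof -
  define a where "a k n = H $ k * ((G ^ k) $ n / G $ n)" for k n
  define b where "b k = H $ k * (real k * (1/2) ^ (k - 1))" for k
  have rad: "ereal (norm (1/2 :: real)) < fps_conv_radius (fps_deriv H)"
    using assms fps_conv_radius_deriv[of H] by (simp add: less_le_trans)
  have b_Suc: "b (Suc k) = fps_deriv H $ k * (1/2) ^ k" for k
    by (simp add: b_def algebra_simps)
  have "summable (\<lambda>k. norm (b (Suc k)))"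
    unfolding b_Suc by (rule norm_summable_fps[OF rad])
  then have norm_b: "summable (\<lambda>k. norm (b k))"
    by (subst (asm) summable_Suc_iff)
  have "suminf b = (\<Sum>k. b (Suc k)) + b 0"
    using suminf_split_head[OF summable_norm_cancel[OF norm_b]] by simp
  then have suminf_b: "suminf b = eval_fps (fps_deriv H) (1/2)"
    by (simp add: b_Suc eval_fps_def b_def[of 0])
  have lim: "(\<lambda>n. a k n) \<longlonglongrightarrow> b k" for k
  proof (cases "k = 0")
    case True
    have "eventually (\<lambda>n. a k n = 0) sequentially"
      using eventually_gt_at_top[of 0] by eventually_elim (simp add: a_def True)
    then show ?thesis by (simp add: b_def True tendsto_eventually)
  next
    case False
    then show ?thesis unfolding a_def b_def by (intro tendsto_mult tendsto_const power_nth_ratio_tendsto) simp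
  qed
  have bound: "norm (a k n) \<le> norm (b k)" if "n > 0" for k n
  proof (cases "k = 0")
    case False
    then have "(G ^ k) $ n / G $ n \<le> real k * (1/2) ^ (k - 1)"
      using power_nth_bound[of k n] nth_pos[OF that] by (simp add: divide_le_eq)
    moreover have "(G ^ k) $ n / G $ n \<ge> 0"
      using power_nth_nonneg[of k n] nth_pos[OF that] by simp
    ultimately show ?thesis
      unfolding a_def b_def norm_mult by (intro mult_left_mono) auto
  qed (use that in \<open>simp add: a_def\<close>)
  have ev: "eventually (\<lambda>(k, n). norm (a k n) \<le> norm (b k)) (at_top \<times>\<^sub>F sequentially)"
    using eventually_prodI[OF always_eventually[of "\<lambda>_ :: nat. True"] eventually_gt_at_top[of "0 :: nat"]]
    by (rule eventually_mono) (auto simp del: real_norm_def intro: bound)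
  have "(\<lambda>n. suminf (\<lambda>k. a k n)) \<longlonglongrightarrow> suminf b"
    using tannerys_theorem[OF lim ev norm_b] by simp
  moreover have "suminf (\<lambda>k. a k n) = (H oo G) $ n / G $ n" for n
  proof -
    \<comment> \<open>Powers beyond \<open>n\<close> do not reach the coefficient \<open>n\<close>,
      as \<open>G\<close> has no constant term.\<close>
    have "suminf (\<lambda>k. a k n) = (\<Sum>k\<in>{0..n}. a k n)"
      by (rule suminf_finite) (use startsby_zero_power_prefix[OF G0] in \<open>auto simp: a_def\<close>)
    then show ?thesis by (simp add: fps_compose_nth a_def sum_divide_distrib)
  qed
  ultimately show ?thesis by (simp add: suminf_b)
qed

text \<open>With n = m + 1 the coefficient is 2^(m+1) times the Catalan number of \<open>m\<close>,
  and the generalised binomial of -1/2 behaves like (-1)^m / sqrt(pi m).\<close>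

lemma nth_asymp_equiv:
  "(\<lambda>n. G $ n) \<sim>[sequentially] (\<lambda>n. 2 ^ (3 * n - 2) / sqrt (pi * real n ^ 3))"
proof (rule asymp_equivI')
  have cb: "real ((2 * m) choose m) = (-1) ^ m * 4 ^ m * ((-1/2) gchoose m)" for m
    by (rule central_binomial_eq_gbinomial)
  have "(\<lambda>m. ((-1/2) gchoose m) / ((-1) ^ m / exp ((-1/2 + 1) * of_real (ln (real m)))))
      \<longlonglongrightarrow> inverse (Gamma (- (-1/2) :: real))"
    by (rule gbinomial_asymptotic)
  then have "(\<lambda>m. ((-1/2) gchoose m) / ((-1) ^ m / exp (1/2 * ln (real m)))) \<longlonglongrightarrow> 1 / sqrt pi"
    by (simp add: Gamma_one_half_real inverse_eq_divide)
  \<comment> \<open>This factor replaces sqrt m, which appears as exp(ln m / 2), by the sqrt(m + 1)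
    coming from sqrt(n^3).\<close>
  moreover have "(\<lambda>m. sqrt pi * (sqrt (real m + 1) / exp (1/2 * ln (real m)))) \<longlonglongrightarrow> sqrt pi * 1"
    by (intro tendsto_mult tendsto_const) real_asymp
  ultimately have "(\<lambda>m. ((-1/2) gchoose m) / ((-1) ^ m / exp (1/2 * ln (real m))) *
      (sqrt pi * (sqrt (real m + 1) / exp (1/2 * ln (real m))))) \<longlonglongrightarrow> 1 / sqrt pi * (sqrt pi * 1)"
    by (rule tendsto_mult)
  moreover have "((-1/2) gchoose m) / ((-1) ^ m / exp (1/2 * ln (real m))) *
      (sqrt pi * (sqrt (real m + 1) / exp (1/2 * ln (real m)))) =
      G $ Suc m / (2 ^ (3 * Suc m - 2) / sqrt (pi * real (Suc m) ^ 3))" for m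
  proof -
    have "real m + 1 \<noteq> 0" by linarith
    then have nth: "G $ Suc m = 2 ^ (m + 1) * ((-1) ^ m * 4 ^ m * ((-1/2) gchoose m)) / (real m + 1)"
      using nth_Suc_eq[of m] unfolding cb by (simp add: field_simps)
    have "sqrt (pi * real (Suc m) ^ 3) = sqrt (pi * (real m + 1) * (real m + 1)\<^sup>2)"
      by (simp add: power2_eq_square power3_eq_cube algebra_simps)
    also have "\<dots> = sqrt pi * sqrt (real m + 1) * (real m + 1)"
      by (simp add: real_sqrt_mult)
    finally have sq: "sqrt (pi * real (Suc m) ^ 3) = sqrt pi * sqrt (real m + 1) * (real m + 1)" .
    have "3 * Suc m - 2 = (m + 1) + 2 * m" by simp
    then have pow: "(2 :: real) ^ (3 * Suc m - 2) = 2 ^ (m + 1) * 4 ^ m"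
      by (simp only: power_add power_mult) simp
    have sign: "((-1) ^ m :: real) = 1 / (-1) ^ m"
      by (simp add: field_simps flip: power_mult_distrib)
    have cancel: "c / (s / e) * (p * (t / e)) = c / s * (p * t)" if "e \<noteq> 0" for c s e p t :: real
      using that by simp
    have "G $ Suc m / (2 ^ (3 * Suc m - 2) / sqrt (pi * real (Suc m) ^ 3)) =
        (-1) ^ m * ((-1/2) gchoose m) * (sqrt pi * sqrt (real m + 1))"
      unfolding nth sq pow using \<open>real m + 1 \<noteq> 0\<close> by simp
    then show ?thesis
      unfolding cancel[OF exp_not_eq_zero] by (subst (asm) sign) simp
  qed
  ultimately show "(\<lambda>n. G $ n / (2 ^ (3 * n - 2) / sqrt (pi * real n ^ 3))) \<longlonglongrightarrow> 1"
    by (subst filterlim_sequentially_Suc[symmetric]) simp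
qed

end

section \<open>Transfer of the asymptotics of \<open>G\<close> to the case 3 rows\<close>

theorem theorem5p3:
  shows "(\<lambda>n. real (t3 n)) \<sim>[sequentially]
    (\<lambda>n. ((2 * sqrt 3 - 3) / 6) * (2 ^ (3 * n - 2) / sqrt (pi * real n ^ 3)))"
proof -
  define F where "F = row_fps False"
  define G where "G = row_fps False + row_fps True"
  have G: "G = 2 * fps_X + G\<^sup>2"
  proof -
    \<comment> \<open>Adding the equations for false and true rows collects all four products into
      G^2.\<close>
    have "G = (fps_X + row_fps True * row_fps False) + (fps_X + (row_fps False * row_fps False +
        row_fps False * row_fps True + row_fps True * row_fps True))"
      unfolding G_def by (rule arg_cong2[where f = "(+)", OF row_fps_False row_fps_True])
    also have "\<dots> = 2 * fps_X + G\<^sup>2"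
      unfolding G_def by (simp add: algebra_simps power2_eq_square)
    finally show ?thesis .
  qed
  have F: "F = fps_X + (G - F) * F"
    using row_fps_False unfolding F_def G_def by simp
  interpret power_fps G
    using G by unfold_locales (simp_all add: G_def)
  have t3: "real (t3 n) = (outer_fps oo G) $ n" for n
    unfolding t3_eq_fps_nth F_def[symmetric]
    using fps_square_eq_compose[OF _ _ G F] G0 by (simp add: F_def)
  define c where "c = (2 * sqrt 3 - 3) / (6 :: real)"
  \<comment> \<open>The limit must be nonzero to turn it into an asymptotic equivalence: sqrt 3
    exceeds 3/2.\<close>
  have "sqrt 3 > sqrt ((3/2)\<^sup>2)"
    unfolding real_sqrt_less_iff by (simp add: power2_eq_square)
  then have c: "c \<noteq> 0" by (simp add: c_def)
  have "ereal (1/2) < fps_conv_radius outer_fps"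
    by (rule less_le_trans[OF _ conv_radius_outer_fps]) simp
  then have lim: "(\<lambda>n. real (t3 n) / G $ n) \<longlonglongrightarrow> c"
    using compose_nth_asymp unfolding t3 c_def eval_deriv_outer_fps[symmetric] by blast
  have "(\<lambda>n. real (t3 n)) \<sim>[sequentially] (\<lambda>n. c * G $ n)"
  proof (rule asymp_equivI')
    show "(\<lambda>n. real (t3 n) / (c * G $ n)) \<longlonglongrightarrow> 1"
      using tendsto_divide[OF lim tendsto_const[of c] c] c by (simp add: mult.commute)
  qed
  also have "(\<lambda>n. c * G $ n) \<sim>[sequentially] (\<lambda>n. c * (2 ^ (3 * n - 2) / sqrt (pi * real n ^ 3)))"
    by (intro asymp_equiv_mult asymp_equiv_refl nth_asymp_equiv)
  finally show ?thesis unfolding c_def .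
qed

end
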